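(* Let $s\ge 2$ be an integer and $A_s=\{e_0,\dots,e_{s-1}\}$ with $0<e_0<e_1<\dots<e_{s-1}$. The set $E=\{[0;a_1,a_2,\dots]: a_n\in A_s\text{ for all } n\ge 1\}$ of values of all infinite $A_s$-continued fractions is bounded, perfect, and has the cardinality of the continuum.
   Context: For a sequence $(a_n)_{n\ge1}$ with $a_n\in A_s$, $[0;a_1,a_2,\dots]$ denotes the value of the infinite continued fraction $\cfrac{1}{a_1+\cfrac{1}{a_2+\cdots}}$, i.e. the limit of its convergents, which exists for all such sequences. A set of reals is perfect if it is closed and has no isolated points. *)

theory Defs
  imports "HOL-Analysis.Analysis"
begin

(* cf_convergent a n is the finite continued fraction [0; a 1, ..., a n].
   Digits are indexed from 1; a 0 is never used. Only positive digits are of interest,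
   so no denominator vanishes. *)
primrec cf_convergent :: "(nat \<Rightarrow> real) \<Rightarrow> nat \<Rightarrow> real" where
  "cf_convergent a 0 = 0"
| "cf_convergent a (Suc n) = 1 / (a 1 + cf_convergent (\<lambda>k. a (Suc k)) n)"

(* For digits drawn from a finite set of positive reals the convergents always converge;
   otherwise lim may be unspecified. *)
definition cf_value :: "(nat \<Rightarrow> real) \<Rightarrow> real" where
  "cf_value a = lim (cf_convergent a)"

definition cf_values :: "real set \<Rightarrow> real set" where
  "cf_values A = {cf_value a | a. \<forall>n\<ge>1. a n \<in> A}"

definition perfect_set :: "'a::topological_space set \<Rightarrow> bool" where
  "perfect_set S \<longleftrightarrow> closed S \<and> (\<forall>x\<in>S. \<not> x isolated_in S)"

lemma cf_convergent_3:
  "cf_convergent a 3 = 1 / (a 1 + 1 / (a 2 + 1 / a 3))"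
  by (simp add: numeral_eq_Suc)

end

theory Submission
  imports Defs
begin

text \<open>
  Let \<open>m > 0\<close> be the least digit. Each map \<open>y \<mapsto> 1 / (d + y)\<close> with a digit \<open>d \<ge> m\<close> sends
  the interval \<open>[0, 1/m]\<close> injectively into itself. A single map need not contract distances
  when \<open>m < 1\<close>, but the composition of two of them shrinks them at least by the factor
  \<open>1 / (1 + m\<^sup>2) < 1\<close> (\<open>two_cf_steps_contract\<close>). Hence, after \<open>n\<close> digits, the influence of the
  remainder on the value decays geometrically in \<open>n\<close> (\<open>cf_tail_contract\<close>). So the convergents
  converge, and the set \<open>E\<close> of values is contained in \<open>[0, 1/m]\<close> and is the union of its images
  under the digit maps.

  \<open>E\<close> is closed: its closure is compact and, as there are finitely many digits, is covered by
  its own images under the digit maps; splitting off digits for ever expresses every point of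
  the closure as a continued fraction (\<open>subset_cf_values\<close>).

  \<open>E\<close> has no isolated points: it has at least two points, so the remainder of an expansion
  after \<open>n\<close> digits can be replaced by a different element of \<open>E\<close>, which changes the value by
  an arbitrarily small nonzero amount when \<open>n\<close> is large (\<open>cf_values_islimpt\<close>).

  Different digit sequences may well have the same value, so the cardinality is not read off
  from the sequences; instead, every nonempty perfect subset of a completely metrizable space
  has at least the cardinality of the continuum.
\<close>

section \<open>Finite continued fractions with a remainder\<close>

text \<open>The finite continued fraction \<open>[0; a 1, \<dots>, a n + y]\<close> with remainder \<open>y\<close>, that is, the
  composition of the first \<open>n\<close> digit maps applied to \<open>y\<close>. As a remainder is itself a continued
  fraction, at most the inverse of its first digit, it is restricted to \<open>[0, 1/m]\<close> in what follows.\<close>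

primrec cf_tail :: "(nat \<Rightarrow> real) \<Rightarrow> nat \<Rightarrow> real \<Rightarrow> real" where
  "cf_tail a 0 y = y"
| "cf_tail a (Suc n) y = 1 / (a 1 + cf_tail (\<lambda>k. a (Suc k)) n y)"

lemma cf_convergent_eq_cf_tail: "cf_convergent a n = cf_tail a n 0"
  by (induction n arbitrary: a) auto

lemma cf_tail_add: "cf_tail a (n + k) y = cf_tail a n (cf_tail (\<lambda>i. a (i + n)) k y)"
  by (induction n arbitrary: a) auto

lemma cf_step_bounds:
  fixes m d y :: real
  assumes "0 < m" "m \<le> d" "0 \<le> y"
  shows "1 / (d + y) \<in> {0..1/m}"
  using assms by (auto simp: field_simps)

lemma cf_tail_bounds:
  assumes "0 < m" "\<And>k. k \<ge> 1 \<Longrightarrow> m \<le> a k" "y \<in> {0..1/m}"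
  shows "cf_tail a n y \<in> {0..1/m}"
  using assms(2)
proof (induction n arbitrary: a)
  case (Suc n)
  have "cf_tail (\<lambda>k. a (Suc k)) n y \<in> {0..1/m}"
    by (rule Suc.IH) (simp add: Suc.prems)
  with cf_step_bounds[OF assms(1) Suc.prems[of 1]] show ?case by simp
qed (use assms in simp)

lemma cf_tail_inj:
  assumes "0 < m" "\<And>k. k \<ge> 1 \<Longrightarrow> m \<le> a k" "y \<in> {0..1/m}" "z \<in> {0..1/m}"
    and "cf_tail a n y = cf_tail a n z"
  shows "y = z"
  using assms(2,5)
proof (induction n arbitrary: a)
  case (Suc n)
  have m: "\<And>k. k \<ge> 1 \<Longrightarrow> m \<le> a (Suc k)" using Suc.prems by simp
  have "cf_tail (\<lambda>k. a (Suc k)) n y = cf_tail (\<lambda>k. a (Suc k)) n z"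
    using Suc.prems(2) by simp
  with Suc.IH[of "\<lambda>k. a (Suc k)"] m show ?case by blast
qed auto

lemma two_cf_steps_contract:
  fixes m p q y z :: real
  assumes "0 < m" "m \<le> p" "m \<le> q" "0 \<le> y" "0 \<le> z"
  shows "\<bar>1 / (p + 1 / (q + y)) - 1 / (p + 1 / (q + z))\<bar> \<le> 1 / (1 + m\<^sup>2) * \<bar>y - z\<bar>"
proof -
  define u v where "u = p * (q + y) + 1" and "v = p * (q + z) + 1"
  have pos: "0 < p" "0 < q + y" "0 < q + z" using assms by auto
  have "m * m \<le> p * (q + y)" "m * m \<le> p * (q + z)"
    using assms by (auto intro!: mult_mono)
  hence uv: "1 + m\<^sup>2 \<le> u" "1 + m\<^sup>2 \<le> v" by (auto simp: u_def v_def power2_eq_square)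
  have m1: "1 \<le> 1 + m\<^sup>2" by simp
  have uv0: "0 < u" "0 < v" using uv m1 by linarith+
  have e: "1 / (p + 1 / (q + y)) = (q + y) / u" "1 / (p + 1 / (q + z)) = (q + z) / v"
    using pos by (auto simp: u_def v_def divide_simps)
  have "(q + y) / u - (q + z) / v = ((q + y) * v - (q + z) * u) / (u * v)"
    using uv0 by (simp add: diff_frac_eq)
  also have "(q + y) * v - (q + z) * u = y - z"
    by (simp add: u_def v_def algebra_simps)
  finally have d: "\<bar>(q + y) / u - (q + z) / v\<bar> = \<bar>y - z\<bar> / (u * v)"
    using uv0 by (simp add: abs_mult)
  have "(1 + m\<^sup>2) * 1 \<le> u * v"
    using uv m1 uv0 by (intro mult_mono) linarith+
  moreover have "0 < 1 + m\<^sup>2" using m1 by linarith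
  ultimately have "\<bar>y - z\<bar> / (u * v) \<le> \<bar>y - z\<bar> / (1 + m\<^sup>2)"
    by (intro divide_left_mono mult_pos_pos uv0) auto
  thus ?thesis unfolding e d by simp
qed

lemma cf_tail_contract:
  assumes "0 < m" "\<And>k. k \<ge> 1 \<Longrightarrow> m \<le> a k" "y \<in> {0..1/m}" "z \<in> {0..1/m}"
  shows "\<bar>cf_tail a n y - cf_tail a n z\<bar> \<le> 1 / m * (1 / (1 + m\<^sup>2)) ^ (n div 2)"
  using assms(2)
proof (induction n arbitrary: a rule: induct_nat_012)
  case 0
  show ?case using assms(3,4) by auto
next
  case 1
  have "cf_tail a 1 w \<in> {0..1/m}" if "w \<in> {0..1/m}" for w
    by (rule cf_tail_bounds[OF assms(1)]) (use 1 that in auto)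
  from this[OF assms(3)] this[OF assms(4)]
  have "\<bar>cf_tail a 1 y - cf_tail a 1 z\<bar> \<le> 1 / m"
    unfolding atLeastAtMost_iff by linarith
  thus ?case by simp
next
  case (ge2 n)
  let ?b = "\<lambda>k. a (Suc (Suc k))"
  have b: "\<And>k. k \<ge> 1 \<Longrightarrow> m \<le> ?b k" using ge2.prems by simp
  have nn: "0 \<le> cf_tail ?b n w" if "w \<in> {0..1/m}" for w
    using cf_tail_bounds[where a = ?b, OF assms(1) b that] by simp
  have "\<bar>cf_tail a (Suc (Suc n)) y - cf_tail a (Suc (Suc n)) z\<bar>
      \<le> 1 / (1 + m\<^sup>2) * \<bar>cf_tail ?b n y - cf_tail ?b n z\<bar>"
    using two_cf_steps_contract[OF assms(1) ge2.prems[of 1] ge2.prems[of 2]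
        nn[OF assms(3)] nn[OF assms(4)]]
    by (simp add: numeral_2_eq_2)
  also have "\<dots> \<le> 1 / (1 + m\<^sup>2) * (1 / m * (1 / (1 + m\<^sup>2)) ^ (n div 2))"
    by (intro mult_left_mono ge2.IH(1) b) auto
  finally show ?case by (simp add: mult_ac)
qed

lemma cf_error_tendsto_0:
  fixes m :: real
  assumes "0 < m"
  shows "(\<lambda>n. 1 / m * (1 / (1 + m\<^sup>2)) ^ (n div 2)) \<longlonglongrightarrow> 0"
proof -
  have "(\<lambda>n. (1 / (1 + m\<^sup>2)) ^ n) \<longlonglongrightarrow> 0"
    using assms by (intro LIMSEQ_power_zero) (auto simp: add_pos_nonneg)
  moreover have "filterlim (\<lambda>n::nat. n div 2) at_top at_top"
    by (rule filterlim_at_top_div_const_nat) simp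
  ultimately have "(\<lambda>n. (1 / (1 + m\<^sup>2)) ^ (n div 2)) \<longlonglongrightarrow> 0"
    by (rule filterlim_compose)
  from tendsto_mult_left[OF this, of "1/m"] show ?thesis by simp
qed

section \<open>Values of infinite continued fractions\<close>

text \<open>If \<open>x\<close> has an expansion with bounded remainders at every depth, then its digits
  determine \<open>x\<close> as the limit of the convergents.\<close>

lemma cf_convergent_tendsto:
  assumes "0 < m" "\<And>k. k \<ge> 1 \<Longrightarrow> m \<le> a k"
    and "\<And>n. y n \<in> {0..1/m}" "\<And>n. x = cf_tail a n (y n)"
  shows "cf_convergent a \<longlonglongrightarrow> x"
proof -
  have "\<bar>cf_convergent a n - x\<bar> \<le> 1 / m * (1 / (1 + m\<^sup>2)) ^ (n div 2)" for n
    using cf_tail_contract[of m a 0 "y n" n] assms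
    by (simp add: cf_convergent_eq_cf_tail flip: assms(4))
  hence "(\<lambda>n. cf_convergent a n - x) \<longlonglongrightarrow> 0"
    by (intro Lim_null_comparison[OF _ cf_error_tendsto_0[OF assms(1)]]) auto
  thus ?thesis by (simp add: LIM_zero_iff)
qed

lemma convergent_cf_convergent:
  assumes "0 < m" "\<And>k. k \<ge> 1 \<Longrightarrow> m \<le> a k"
  shows "convergent (cf_convergent a)"
proof -
  let ?r = "\<lambda>n. 1 / m * (1 / (1 + m\<^sup>2)) ^ (n div 2)"
  have *: "\<bar>cf_convergent a i - cf_convergent a n\<bar> \<le> ?r n" if le: "n \<le> i" for i n
  proof -
    obtain k where i: "i = n + k" using le_Suc_ex[OF le] by auto
    have "cf_tail (\<lambda>i. a (i + n)) k 0 \<in> {0..1/m}"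
      by (rule cf_tail_bounds) (use assms in auto)
    thus ?thesis
      unfolding i cf_convergent_eq_cf_tail cf_tail_add
      by (intro cf_tail_contract assms) (use assms in auto)
  qed
  have "Cauchy (cf_convergent a)"
  proof (rule CauchyI')
    fix \<epsilon> :: real assume "\<epsilon> > 0"
    then obtain N where N: "\<And>n. n \<ge> N \<Longrightarrow> ?r n < \<epsilon>"
      using order_tendstoD(2)[OF cf_error_tendsto_0[OF assms(1)]]
      unfolding eventually_sequentially by blast
    have "dist (cf_convergent a n) (cf_convergent a i) < \<epsilon>" if "n \<ge> N" "i > n" for n i
      using *[of n i] N[of n] that by (simp add: dist_real_def abs_minus_commute)
    thus "\<exists>M. \<forall>n\<ge>M. \<forall>i>n. dist (cf_convergent a n) (cf_convergent a i) < \<epsilon>" by blast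
  qed
  thus ?thesis by (simp add: Cauchy_convergent_iff)
qed

lemma cf_value_bounds:
  assumes "0 < m" "\<And>k. k \<ge> 1 \<Longrightarrow> m \<le> a k"
  shows "cf_value a \<in> {0..1/m}"
proof -
  have "cf_convergent a \<longlonglongrightarrow> cf_value a"
    using convergent_cf_convergent[of m a] assms by (simp add: cf_value_def convergent_LIMSEQ_iff)
  moreover have "cf_convergent a n \<in> {0..1/m}" for n
    unfolding cf_convergent_eq_cf_tail by (rule cf_tail_bounds) (use assms in auto)
  ultimately show ?thesis
    by (intro Lim_in_closed_set[of "{0..1/m}"]) auto
qed

lemma cf_value_Suc:
  assumes "0 < m" "\<And>k. k \<ge> 1 \<Longrightarrow> m \<le> a k"
  shows "cf_value a = 1 / (a 1 + cf_value (\<lambda>k. a (Suc k)))"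
proof -
  let ?b = "\<lambda>k. a (Suc k)"
  have b: "\<And>k. k \<ge> 1 \<Longrightarrow> m \<le> ?b k" using assms by simp
  have lim: "cf_convergent c \<longlonglongrightarrow> cf_value c" if "\<And>k. k \<ge> 1 \<Longrightarrow> m \<le> c k" for c
    using convergent_cf_convergent[of m c] assms(1) that
    by (simp add: cf_value_def convergent_LIMSEQ_iff)
  have "a 1 + cf_value ?b > 0"
    using cf_value_bounds[of m ?b] assms(1) b assms(2)[of 1] by auto
  hence "(\<lambda>n. 1 / (a 1 + cf_convergent ?b n)) \<longlonglongrightarrow> 1 / (a 1 + cf_value ?b)"
    by (intro tendsto_intros lim b) auto
  moreover have "(\<lambda>n. cf_convergent a (Suc n)) \<longlonglongrightarrow> cf_value a"
    by (rule LIMSEQ_Suc[OF lim[OF assms(2)]])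
  ultimately show ?thesis using LIMSEQ_unique by fastforce
qed

lemma cf_value_eq_cf_tail:
  assumes "0 < m" "\<And>k. k \<ge> 1 \<Longrightarrow> m \<le> a k"
  shows "cf_value a = cf_tail a n (cf_value (\<lambda>k. a (k + n)))"
  using assms(2)
proof (induction n arbitrary: a)
  case (Suc n)
  have b: "\<And>k. k \<ge> 1 \<Longrightarrow> m \<le> a (Suc k)" using Suc.prems by simp
  have "cf_value a = 1 / (a 1 + cf_value (\<lambda>k. a (Suc k)))"
    by (rule cf_value_Suc[OF assms(1) Suc.prems])
  also have "cf_value (\<lambda>k. a (Suc k)) = cf_tail (\<lambda>k. a (Suc k)) n (cf_value (\<lambda>k. a (Suc (k + n))))"
    by (rule Suc.IH[OF b])
  finally show ?case by simp
qed auto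

section \<open>The set of values over a digit set\<close>

lemma cf_values_subset:
  assumes "0 < m" "\<And>d. d \<in> A \<Longrightarrow> m \<le> d"
  shows "cf_values A \<subseteq> {0..1/m}"
proof
  fix x assume "x \<in> cf_values A"
  then obtain a where a: "x = cf_value a" "\<And>k. k \<ge> 1 \<Longrightarrow> a k \<in> A"
    unfolding cf_values_def by blast
  show "x \<in> {0..1/m}"
    unfolding a(1) using assms a(2) by (intro cf_value_bounds) auto
qed

text \<open>The set of values is invariant under the iterated function system of the maps
  \<open>y \<mapsto> 1 / (d + y)\<close>.\<close>

lemma cf_values_eq_Union:
  assumes "0 < m" "\<And>d. d \<in> A \<Longrightarrow> m \<le> d"
  shows "cf_values A = (\<Union>d\<in>A. (\<lambda>y. 1 / (d + y)) ` cf_values A)"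
proof (intro equalityI subsetI)
  fix x assume "x \<in> cf_values A"
  then obtain a where a: "x = cf_value a" "\<And>n. n \<ge> 1 \<Longrightarrow> a n \<in> A"
    unfolding cf_values_def by blast
  have "cf_value (\<lambda>k. a (Suc k)) \<in> cf_values A"
    unfolding cf_values_def using a(2) by auto
  with cf_value_Suc[of m a] a assms
  show "x \<in> (\<Union>d\<in>A. (\<lambda>y. 1 / (d + y)) ` cf_values A)" by fastforce
next
  fix x assume "x \<in> (\<Union>d\<in>A. (\<lambda>y. 1 / (d + y)) ` cf_values A)"
  then obtain d b where d: "d \<in> A" "x = 1 / (d + cf_value b)" "\<And>n. n \<ge> 1 \<Longrightarrow> b n \<in> A"
    unfolding cf_values_def by blast
  \<comment> \<open>Digits start at index 1, so \<open>d\<close> has to take the place of the digit at index 1.\<close>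
  define a where "a = (\<lambda>k. if k \<le> 1 then d else b (k - 1))"
  have aA: "\<And>n. n \<ge> 1 \<Longrightarrow> a n \<in> A" using d by (auto simp: a_def)
  have "(\<lambda>k. a (Suc k)) = b(0 := d)" by (auto simp: a_def)
  \<comment> \<open>The entry at index 0 does not affect the value.\<close>
  moreover have "cf_value (b(0 := d)) = cf_value b"
  proof -
    have "cf_tail (b(0 := d)) n y = cf_tail b n y" for n y
      by (cases n) (auto simp: fun_upd_def)
    thus ?thesis unfolding cf_value_def by (simp add: cf_convergent_eq_cf_tail[abs_def])
  qed
  ultimately have "cf_value a = x"
    using cf_value_Suc[of m a] aA assms d by (simp add: a_def)
  thus "x \<in> cf_values A" unfolding cf_values_def using aA by blast
qed

lemma cf_tail_in_cf_values:
  assumes "0 < m" "\<And>d. d \<in> A \<Longrightarrow> m \<le> d" "\<And>k. k \<ge> 1 \<Longrightarrow> a k \<in> A" "y \<in> cf_values A"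
  shows "cf_tail a n y \<in> cf_values A"
  using assms(3)
proof (induction n arbitrary: a)
  case (Suc n)
  have "cf_tail (\<lambda>k. a (Suc k)) n y \<in> cf_values A"
    by (rule Suc.IH) (simp add: Suc.prems)
  with Suc.prems[of 1] show ?case
    by (subst cf_values_eq_Union[OF assms(1,2)]) auto
qed (use assms in simp)

text \<open>A set of bounded remainders that is covered by its images consists of values: digits and remainders can be split off
  for ever, and the contraction makes the convergents tend to the given point.\<close>

lemma subset_cf_values:
  assumes "0 < m" "\<And>d. d \<in> A \<Longrightarrow> m \<le> d"
    and "F \<subseteq> {0..1/m}" "F \<subseteq> (\<Union>d\<in>A. (\<lambda>y. 1 / (d + y)) ` F)"
  shows "F \<subseteq> cf_values A"
proof
  fix x assume x: "x \<in> F"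
  have "\<forall>z\<in>F. \<exists>d y. d \<in> A \<and> y \<in> F \<and> z = 1 / (d + y)" using assms(4) by blast
  then obtain D Y where DY: "\<And>z. z \<in> F \<Longrightarrow> D z \<in> A \<and> Y z \<in> F \<and> z = 1 / (D z + Y z)"
    by metis
  \<comment> \<open>\<open>(Y ^^ n) z\<close> is the remainder after \<open>n\<close> digits, so \<open>D\<close> of it is the digit \<open>n + 1\<close>.\<close>
  define a where "a z = (\<lambda>k. D ((Y ^^ (k - 1)) z))" for z
  have YF: "(Y ^^ n) z \<in> F" if "z \<in> F" for n z
    using that DY by (induction n) auto
  have aA: "a z k \<in> A" if "z \<in> F" for z k using DY YF that by (simp add: a_def)
  have shift: "cf_tail (\<lambda>k. a z (Suc k)) n y = cf_tail (a (Y z)) n y" for z n y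
  proof -
    have *: "cf_tail b n y = cf_tail c n y" if "\<And>k. k \<ge> 1 \<Longrightarrow> b k = c k" for b c
      using that
    proof (induction n arbitrary: b c)
      case (Suc n)
      have "cf_tail (\<lambda>k. b (Suc k)) n y = cf_tail (\<lambda>k. c (Suc k)) n y"
        by (rule Suc.IH) (simp add: Suc.prems)
      thus ?case using Suc.prems by simp
    qed simp
    have "a z (Suc k) = a (Y z) k" if "k \<ge> 1" for k
      using that by (cases k) (auto simp: a_def funpow_swap1)
    thus ?thesis by (rule *)
  qed
  have "z = cf_tail (a z) n ((Y ^^ n) z)" if "z \<in> F" for z n
    using that
  proof (induction n arbitrary: z)
    case (Suc n)
    have "Y z = cf_tail (a (Y z)) n ((Y ^^ n) (Y z))" using Suc DY by blast
    moreover have "z = 1 / (D z + Y z)" using Suc.prems DY by blast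
    moreover have "a z 1 = D z" by (simp add: a_def)
    ultimately show ?case by (simp add: shift funpow_swap1)
  qed simp
  hence "cf_convergent (a x) \<longlonglongrightarrow> x"
    using assms(1-3) x aA YF
    by (intro cf_convergent_tendsto[of m "a x" "\<lambda>n. (Y ^^ n) x"]) blast+
  hence "x = cf_value (a x)" unfolding cf_value_def by (rule limI[symmetric])
  thus "x \<in> cf_values A" unfolding cf_values_def using aA[OF x] by blast
qed

text \<open>The closure of the set of values is also covered by its images under the digit maps,
  because a continuous image of a compact set is closed and there are only finitely many
  digits.\<close>

lemma closed_cf_values:
  assumes "finite A" "0 < m" "\<And>d. d \<in> A \<Longrightarrow> m \<le> d"
  shows "closed (cf_values A)"
proof -
  let ?E = "cf_values A"
  have sub: "closure ?E \<subseteq> {0..1/m}"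
    using cf_values_subset[OF assms(2,3)] by (intro closure_minimal) auto
  have "compact (closure ?E)"
    using sub by (meson bounded_closed_interval bounded_subset closed_closure compact_eq_bounded_closed)
  moreover have "continuous_on (closure ?E) (\<lambda>y. 1 / (d + y))" if "d \<in> A" for d
  proof (intro continuous_intros ballI)
    fix y assume "y \<in> closure ?E"
    with sub assms(2) assms(3)[OF that] show "d + y \<noteq> 0" by fastforce
  qed
  ultimately have "closed ((\<lambda>y. 1 / (d + y)) ` closure ?E)" if "d \<in> A" for d
    using that by (blast intro: compact_imp_closed compact_continuous_image)
  hence "closed (\<Union>d\<in>A. (\<lambda>y. 1 / (d + y)) ` closure ?E)"
    using assms(1) by blast
  moreover have "?E \<subseteq> (\<Union>d\<in>A. (\<lambda>y. 1 / (d + y)) ` closure ?E)"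
    using closure_subset[of ?E] by (subst cf_values_eq_Union[OF assms(2,3)]) blast+
  ultimately have "closure ?E \<subseteq> (\<Union>d\<in>A. (\<lambda>y. 1 / (d + y)) ` closure ?E)"
    by (rule closure_minimal[rotated])
  from subset_cf_values[OF assms(2,3) sub this] show ?thesis
    by (simp add: closure_subset_eq)
qed

text \<open>The value \<open>v\<close> of a constant digit sequence \<open>d, d, \<dots>\<close> solves \<open>v * (d + v) = 1\<close>, so it
  determines \<open>d\<close>.\<close>

lemma cf_values_two_points:
  assumes "0 < m" "\<And>d. d \<in> A \<Longrightarrow> m \<le> d" "p \<in> A" "q \<in> A" "p \<noteq> q"
  shows "\<exists>y\<in>cf_values A. y \<noteq> x"
proof -
  have fixpoint: "cf_value (\<lambda>_. d) * (d + cf_value (\<lambda>_. d)) = 1" if "d \<in> A" for d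
    using cf_value_Suc[of m "\<lambda>_. d"] cf_value_bounds[of m "\<lambda>_. d"] assms(1,2) that
    by (smt (verit, best) atLeastAtMost_iff nonzero_eq_divide_eq)
  have "cf_value (\<lambda>_. p) \<noteq> cf_value (\<lambda>_. q)"
  proof
    assume eq: "cf_value (\<lambda>_. p) = cf_value (\<lambda>_. q)"
    have "cf_value (\<lambda>_. p) * p = cf_value (\<lambda>_. p) * q"
      using fixpoint[OF assms(3)] fixpoint[OF assms(4)] unfolding eq distrib_left by linarith
    with fixpoint[OF assms(3)] assms(5) show False by auto
  qed
  moreover have "cf_value (\<lambda>_. d) \<in> cf_values A" if "d \<in> A" for d
    unfolding cf_values_def using that by blast
  ultimately show ?thesis using assms(3,4) by metis
qed

text \<open>Changing the remainder of an expansion after \<open>n\<close> digits moves its value, by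
  injectivity, but only by an amount that tends to zero as \<open>n\<close> grows. Distinct digit sequences may
  have equal values, so it is the remainder, and not just the digits, that has to change.\<close>

lemma cf_values_islimpt:
  assumes "0 < m" "\<And>d. d \<in> A \<Longrightarrow> m \<le> d" "p \<in> A" "q \<in> A" "p \<noteq> q"
    and "x \<in> cf_values A"
  shows "x islimpt cf_values A"
  unfolding islimpt_approachable
proof (intro allI impI)
  fix \<epsilon> :: real assume "\<epsilon> > 0"
  then obtain n where n: "1 / m * (1 / (1 + m\<^sup>2)) ^ (n div 2) < \<epsilon>"
    using order_tendstoD(2)[OF cf_error_tendsto_0[OF assms(1)]]
    unfolding eventually_sequentially by blast
  obtain a where a: "x = cf_value a" "\<And>n. n \<ge> 1 \<Longrightarrow> a n \<in> A"
    using assms(6) unfolding cf_values_def by blast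
  have m: "\<And>k. k \<ge> 1 \<Longrightarrow> m \<le> a k" using a(2) assms(2) by blast
  define z where "z = cf_value (\<lambda>k. a (k + n))"
  have z: "z \<in> {0..1/m}"
    unfolding z_def by (rule cf_value_bounds) (use m assms in auto)
  have x: "x = cf_tail a n z"
    unfolding z_def a(1) by (rule cf_value_eq_cf_tail[OF assms(1) m])
  obtain y where y: "y \<in> cf_values A" "y \<noteq> z"
    using cf_values_two_points[OF assms(1-5)] by blast
  have y': "y \<in> {0..1/m}" using y(1) cf_values_subset[OF assms(1,2)] by blast
  have "cf_tail a n y \<in> cf_values A"
    by (rule cf_tail_in_cf_values[OF assms(1,2) a(2) y(1)])
  moreover have "cf_tail a n y \<noteq> x"
    using cf_tail_inj[where a = a, OF assms(1) m y' z] y(2) x by blast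
  moreover have "dist (cf_tail a n y) x < \<epsilon>"
    using cf_tail_contract[where a = a and n = n, OF assms(1) m y' z] n x by (simp add: dist_real_def)
  ultimately show "\<exists>x'\<in>cf_values A. x' \<noteq> x \<and> dist x' x < \<epsilon>" by blast
qed

theorem theorem14:
  fixes s :: nat and e :: "nat \<Rightarrow> real" and A E :: "real set"
  assumes s: "s \<ge> 2"
    and pos: "0 < e 0"
    and incr: "strict_mono_on {..<s} e"
    and A: "A = e ` {..<s}"
    and E: "E = cf_values A"
  shows "bounded E \<and> perfect_set E \<and> E \<approx> (UNIV :: real set)"
proof -
  have m: "e 0 \<le> d" if "d \<in> A" for d
    using that s strict_mono_on_leD[OF incr] unfolding A by auto
  have pq: "e 0 \<in> A" "e 1 \<in> A" "e 0 \<noteq> e 1"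
    using s strict_mono_onD[OF incr, of 0 1] unfolding A by auto
  have fin: "finite A" unfolding A by simp
  have closed: "closed E" unfolding E by (rule closed_cf_values[OF fin pos m])
  have limpt: "x islimpt E" if "x \<in> E" for x
    using cf_values_islimpt[OF pos m pq] that unfolding E by blast
  have "bounded E"
    unfolding E by (rule bounded_subset[OF bounded_closed_interval cf_values_subset[OF pos m]])
  moreover have "perfect_set E"
    unfolding perfect_set_def using closed limpt
    by (auto simp: isolated_in_islimpt_iff)
  moreover have "E \<approx> (UNIV :: real set)"
  proof (rule lepoll_antisym)
    show "E \<lesssim> (UNIV :: real set)" by (rule subset_imp_lepoll) simp
    have "x \<in> euclidean derived_set_of E \<longleftrightarrow> x islimpt E" for x
      unfolding derived_set_of_def islimpt_def by (simp, blast)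
    hence "euclidean derived_set_of E = E"
      using closed limpt unfolding closed_limpt by blast
    moreover have "E \<noteq> {}" unfolding E using cf_values_two_points[OF pos m pq] by blast
    ultimately show "(UNIV :: real set) \<lesssim> E"
      by (intro lepoll_perfect_set[of euclidean]) (auto simp: completely_metrizable_space_euclidean)
  qed
  ultimately show ?thesis by blast
qed

end
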